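(* Let $q\ge1$ be real, ${\sf m}=(m_1,\dots,m_\ell)$ a composition of $n$, and ${\sf x}=(x_1,\dots,x_n)$ positive reals with sum $1$ which are ${\sf m}$-compatible; put $\overline{x}_j=[m_j]_q\,x_{n_j}$. Let $\mathrm{proj}_{W_{\sf m}}:\mathbb{R}[\mathfrak{S}_n]\to\mathbb{R}[W_{\sf m}]$ and $\mathrm{incl}_{\mathfrak{S}_n}:\mathbb{R}[W_{\sf m}]\to\mathbb{R}[\mathfrak{S}_n]$ be the linear maps in the context. Then for all $\pi\in\mathfrak{S}_n$ and $w\in W_{\sf m}$, \[ \mathrm{proj}_{W_{\sf m}}(\pi\cdot\mathcal{T}_{\mathfrak{S}_n}(q,{\sf x}))=\mathrm{proj}_{W_{\sf m}}(\pi)\cdot\mathcal{T}_{W_{\sf m}}(q,\overline{{\sf x}}),\qquad \mathrm{incl}_{\mathfrak{S}_n}(w\cdot\mathcal{T}_{W_{\sf m}}(q,\overline{{\sf x}}))=\mathrm{incl}_{\mathfrak{S}_n}(w)\cdot\mathcal{T}_{\mathfrak{S}_n}(q,{\sf x}). \]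
   Context: $[m]_q=1+q+\cdots+q^{m-1}$; $n_j=m_1+\cdots+m_j$ ($n_0=0$), $M_j=\{n_{j-1}+1,\dots,n_j\}$. ${\sf x}$ is ${\sf m}$-compatible if $y_i=x_i/q^{n-i}$ is constant on each $M_j$. $W_{\sf m}$ is the set of words of length $n$ in $\{1,\dots,\ell\}$ with $m_j$ copies of $j$. Permutations (one-line notation): $\pi\cdot T_i=q\,\pi s_i$ if $\pi_{i+1}<\pi_i$, $\pi\cdot T_i=\pi s_i+(q-1)\pi$ if $\pi_{i+1}>\pi_i$ ($\pi s_i$ swaps positions $i,i+1$); $\pi\cdot\mathcal{X}=\frac{x_{\pi_1}}{q^{n-\pi_1}}\pi$; $\mathcal{T}_{\mathfrak{S}_n}(q,{\sf x})=\sum_{i=1}^nT_{i-1}\cdots T_1\mathcal{X}$ acting on the right (apply $T_{i-1}$ first, …, $T_1$, then $\mathcal{X}$; $i=1$ term is $\mathcal{X}$). Words: $w\cdot T_i=q\,ws_i$ if $w_{i+1}\le w_i$, $w\cdot T_i=ws_i+(q-1)w$ if $w_{i+1}>w_i$; $w\cdot\mathcal{X}=\frac{\overline{x}_{w_1}}{q^{m_{w_1+1}+\cdots+m_\ell}[m_{w_1}]_q}w$; $\mathcal{T}_{W_{\sf m}}(q,\overline{{\sf x}})=\sum_{i=1}^nT_{i-1}\cdots T_1\mathcal{X}$ similarly. Maps: ${\sf destd}_{\sf m}(\pi)$ replaces each letter of $\pi$ lying in $M_j$ by $j$; ${\sf std}(w)$ replaces, from left to right, the occurrences of letter $j$ in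 $w$ by $n_{j-1}+1,n_{j-1}+2,\dots,n_j$. $\mathfrak{S}_{\sf m}=\mathfrak{S}_{M_1}\times\cdots\times\mathfrak{S}_{M_\ell}$ (permutations of $[n]$ preserving each $M_j$), and for $\tau\in\mathfrak{S}_{\sf m}$, $\mathrm{inv}_{\sf m}(\tau)=\sum_j\mathrm{inv}(\tau|_{M_j})$. Then $\mathrm{proj}_{W_{\sf m}}(\pi)={\sf destd}_{\sf m}(\pi)$ and $\mathrm{incl}_{\mathfrak{S}_n}(w)=\sum_{\tau\in\mathfrak{S}_{\sf m}}q^{-\mathrm{inv}_{\sf m}(\tau)}\,\tau\circ{\sf std}(w)$, where $\tau\circ{\sf std}(w)$ is the permutation obtained by applying $\tau$ to each letter (value) of ${\sf std}(w)$. *)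

theory Defs
  imports "HOL-Analysis.Finite_Function_Topology" "HOL-Combinatorics.Permutations"
begin

text \<open>
  Indices, letters and positions are 1-based as on paper: a sequence indexed by
  \<open>1, \<dots>, k\<close> is a function on \<^typ>\<open>nat\<close> of which only the values on \<open>{1..k}\<close> matter.
  \<open>\<real>[B]\<close> is modelled by finitely supported functions \<^typ>\<open>'b \<Rightarrow>\<^sub>0 real\<close> whose keys
  lie in \<open>B\<close>; a basis element \<open>b\<close> becomes \<open>basis b\<close>.
\<close>

abbreviation basis :: "'b \<Rightarrow> ('b \<Rightarrow>\<^sub>0 real)" where
  "basis b \<equiv> Poly_Mapping.single b 1"

definition lin_extend :: "('b \<Rightarrow> ('c \<Rightarrow>\<^sub>0 real)) \<Rightarrow> ('b \<Rightarrow>\<^sub>0 real) \<Rightarrow> ('c \<Rightarrow>\<^sub>0 real)" where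
  "lin_extend f v = (\<Sum>b\<in>Poly_Mapping.keys v. Poly_Mapping.lookup v b *\<^sub>R f b)"

lemma lookup_scaleR: "Poly_Mapping.lookup (r *\<^sub>R v) b = r * Poly_Mapping.lookup v b"
  for v :: "'b \<Rightarrow>\<^sub>0 real"
proof -
  have "finite {i. r *\<^sub>R Poly_Mapping.lookup v i \<noteq> 0}"
    by (rule finite_subset[OF _ finite_keys[of v]]) (auto simp: in_keys_iff)
  then show ?thesis
    by (simp add: scaleR_poly_mapping_def)
qed

lemma lin_extend_basis: "lin_extend f (basis b) = f b"
  by (simp add: lin_extend_def)

lemma linear_lin_extend: "linear (lin_extend f)"
proof -
  have superset: "lin_extend f v = (\<Sum>b\<in>A. Poly_Mapping.lookup v b *\<^sub>R f b)"
    if "finite A" "Poly_Mapping.keys v \<subseteq> A" for v A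
    unfolding lin_extend_def using that
    by (intro sum.mono_neutral_left) (auto simp: in_keys_iff)
  show ?thesis
  proof (rule linearI)
    fix u v :: "'a \<Rightarrow>\<^sub>0 real" and r :: real
    let ?A = "Poly_Mapping.keys u \<union> Poly_Mapping.keys v"
    show "lin_extend f (u + v) = lin_extend f u + lin_extend f v"
      using superset[of ?A "u + v"] superset[of ?A u] superset[of ?A v] keys_add[of u v]
      by (simp add: lookup_add scaleR_left_distrib sum.distrib)
    have "Poly_Mapping.keys (r *\<^sub>R u) \<subseteq> Poly_Mapping.keys u"
      by (auto simp: in_keys_iff lookup_scaleR)
    then show "lin_extend f (r *\<^sub>R u) = r *\<^sub>R lin_extend f u"
      using superset[of "Poly_Mapping.keys u" "r *\<^sub>R u"] superset[of "Poly_Mapping.keys u" u]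
      by (simp add: lookup_scaleR scaleR_right.sum)
  qed
qed

definition qint :: "real \<Rightarrow> nat \<Rightarrow> real" where
  "qint q k = (\<Sum>i<k. q ^ i)"

definition composition :: "nat \<Rightarrow> nat \<Rightarrow> (nat \<Rightarrow> nat) \<Rightarrow> bool" where
  "composition n l m \<longleftrightarrow> (\<forall>j\<in>{1..l}. 0 < m j) \<and> sum m {1..l} = n"

definition psum :: "(nat \<Rightarrow> nat) \<Rightarrow> nat \<Rightarrow> nat" where
  "psum m j = sum m {1..j}"

definition block :: "(nat \<Rightarrow> nat) \<Rightarrow> nat \<Rightarrow> nat set" where
  "block m j = {psum m (j - 1) + 1..psum m j}"

definition compatible :: "real \<Rightarrow> nat \<Rightarrow> nat \<Rightarrow> (nat \<Rightarrow> nat) \<Rightarrow> (nat \<Rightarrow> real) \<Rightarrow> bool" where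
  "compatible q n l m x \<longleftrightarrow>
     (\<forall>j\<in>{1..l}. (\<lambda>i. x i / q ^ (n - i)) constant_on block m j)"

text \<open>
  A permutation \<open>\<pi>\<close> of \<open>{1..n}\<close> is identified with its one-line notation, \<open>\<pi> i\<close> being the
  letter in position \<open>i\<close>, so \<open>\<pi> s\<^sub>i\<close> is \<open>\<pi> \<circ> transpose i (Suc i)\<close>. Likewise words are
  extensional functions on \<open>{1..n}\<close>.
\<close>

definition words :: "nat \<Rightarrow> nat \<Rightarrow> (nat \<Rightarrow> nat) \<Rightarrow> (nat \<Rightarrow> nat) set" where
  "words n l m =
     {w \<in> {1..n} \<rightarrow>\<^sub>E {1..l}. \<forall>j\<in>{1..l}. card {i\<in>{1..n}. w i = j} = m j}"

text \<open>The right action of \<open>\<Sum>i=1..n. T\<^bsub>i-1\<^esub> \<cdots> T\<^sub>1 X\<close>: \<open>T\<^bsub>i-1\<^esub>\<close> is applied first and \<open>X\<close> last.\<close>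

definition right_act ::
    "nat \<Rightarrow> (nat \<Rightarrow> ('b \<Rightarrow>\<^sub>0 real) \<Rightarrow> ('b \<Rightarrow>\<^sub>0 real)) \<Rightarrow> (('b \<Rightarrow>\<^sub>0 real) \<Rightarrow> ('b \<Rightarrow>\<^sub>0 real))
     \<Rightarrow> ('b \<Rightarrow>\<^sub>0 real) \<Rightarrow> ('b \<Rightarrow>\<^sub>0 real)" where
  "right_act n T X v = (\<Sum>i=1..n. X (foldl (\<lambda>u k. T k u) v (rev [1..<i])))"

definition perm_T :: "real \<Rightarrow> nat \<Rightarrow> ((nat \<Rightarrow> nat) \<Rightarrow>\<^sub>0 real) \<Rightarrow> ((nat \<Rightarrow> nat) \<Rightarrow>\<^sub>0 real)" where
  "perm_T q i = lin_extend (\<lambda>\<pi>.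
     if \<pi> (Suc i) < \<pi> i then q *\<^sub>R basis (\<pi> \<circ> transpose i (Suc i))
     else basis (\<pi> \<circ> transpose i (Suc i)) + (q - 1) *\<^sub>R basis \<pi>)"

definition perm_X ::
    "real \<Rightarrow> nat \<Rightarrow> (nat \<Rightarrow> real) \<Rightarrow> ((nat \<Rightarrow> nat) \<Rightarrow>\<^sub>0 real) \<Rightarrow> ((nat \<Rightarrow> nat) \<Rightarrow>\<^sub>0 real)" where
  "perm_X q n x = lin_extend (\<lambda>\<pi>. (x (\<pi> 1) / q ^ (n - \<pi> 1)) *\<^sub>R basis \<pi>)"

definition perm_act ::
    "real \<Rightarrow> nat \<Rightarrow> (nat \<Rightarrow> real) \<Rightarrow> ((nat \<Rightarrow> nat) \<Rightarrow>\<^sub>0 real) \<Rightarrow> ((nat \<Rightarrow> nat) \<Rightarrow>\<^sub>0 real)" where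
  "perm_act q n x = right_act n (perm_T q) (perm_X q n x)"

definition word_T :: "real \<Rightarrow> nat \<Rightarrow> ((nat \<Rightarrow> nat) \<Rightarrow>\<^sub>0 real) \<Rightarrow> ((nat \<Rightarrow> nat) \<Rightarrow>\<^sub>0 real)" where
  "word_T q i = lin_extend (\<lambda>w.
     if w (Suc i) \<le> w i then q *\<^sub>R basis (w \<circ> transpose i (Suc i))
     else basis (w \<circ> transpose i (Suc i)) + (q - 1) *\<^sub>R basis w)"

definition word_X ::
    "real \<Rightarrow> nat \<Rightarrow> (nat \<Rightarrow> nat) \<Rightarrow> (nat \<Rightarrow> real) \<Rightarrow> ((nat \<Rightarrow> nat) \<Rightarrow>\<^sub>0 real) \<Rightarrow> ((nat \<Rightarrow> nat) \<Rightarrow>\<^sub>0 real)" where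
  "word_X q l m xbar = lin_extend (\<lambda>w.
     (xbar (w 1) / (q ^ (sum m {w 1 + 1..l}) * qint q (m (w 1)))) *\<^sub>R basis w)"

definition word_act ::
    "real \<Rightarrow> nat \<Rightarrow> nat \<Rightarrow> (nat \<Rightarrow> nat) \<Rightarrow> (nat \<Rightarrow> real)
     \<Rightarrow> ((nat \<Rightarrow> nat) \<Rightarrow>\<^sub>0 real) \<Rightarrow> ((nat \<Rightarrow> nat) \<Rightarrow>\<^sub>0 real)" where
  "word_act q n l m xbar = right_act n (word_T q) (word_X q l m xbar)"

definition destd :: "nat \<Rightarrow> nat \<Rightarrow> (nat \<Rightarrow> nat) \<Rightarrow> (nat \<Rightarrow> nat) \<Rightarrow> (nat \<Rightarrow> nat)" where
  "destd n l m \<pi> = (\<lambda>i\<in>{1..n}. THE j. j \<in> {1..l} \<and> \<pi> i \<in> block m j)"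

text \<open>The \<open>r\<close>-th occurrence of the letter \<open>j\<close>, from the left, becomes \<open>psum m (j - 1) + r\<close>.\<close>

definition std :: "nat \<Rightarrow> (nat \<Rightarrow> nat) \<Rightarrow> (nat \<Rightarrow> nat) \<Rightarrow> (nat \<Rightarrow> nat)" where
  "std n m w = (\<lambda>i. if i \<in> {1..n}
     then psum m (w i - 1) + card {k\<in>{1..i}. w k = w i} else i)"

definition young :: "nat \<Rightarrow> nat \<Rightarrow> (nat \<Rightarrow> nat) \<Rightarrow> (nat \<Rightarrow> nat) set" where
  "young n l m = {\<tau>. \<tau> permutes {1..n} \<and> (\<forall>j\<in>{1..l}. \<tau> ` block m j = block m j)}"

definition inv_m :: "nat \<Rightarrow> (nat \<Rightarrow> nat) \<Rightarrow> (nat \<Rightarrow> nat) \<Rightarrow> nat" where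
  "inv_m l m \<tau> =
     (\<Sum>j=1..l. card {(a, b). a \<in> block m j \<and> b \<in> block m j \<and> a < b \<and> \<tau> b < \<tau> a})"

definition proj_words ::
    "nat \<Rightarrow> nat \<Rightarrow> (nat \<Rightarrow> nat) \<Rightarrow> ((nat \<Rightarrow> nat) \<Rightarrow>\<^sub>0 real) \<Rightarrow> ((nat \<Rightarrow> nat) \<Rightarrow>\<^sub>0 real)" where
  "proj_words n l m = lin_extend (\<lambda>\<pi>. basis (destd n l m \<pi>))"

definition incl_perms ::
    "real \<Rightarrow> nat \<Rightarrow> nat \<Rightarrow> (nat \<Rightarrow> nat) \<Rightarrow> ((nat \<Rightarrow> nat) \<Rightarrow>\<^sub>0 real) \<Rightarrow> ((nat \<Rightarrow> nat) \<Rightarrow>\<^sub>0 real)" where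
  "incl_perms q n l m = lin_extend (\<lambda>w.
     \<Sum>\<tau>\<in>young n l m. (1 / q ^ inv_m l m \<tau>) *\<^sub>R basis (\<tau> \<circ> std n m w))"

end

theory Submission
  imports Defs
begin

text \<open>
  Both maps intertwine each \<open>T\<^sub>i\<close> and \<open>X\<close> separately on basis elements, and this passes to
  \<open>\<Sum>i. T\<^bsub>i-1\<^esub> \<cdots> T\<^sub>1 X\<close> by linearity. For \<open>X\<close>, compatibility makes the eigenvalue depend only on the
  block of the first letter. For \<open>T\<^sub>i\<close>, letters in distinct blocks are ordered like their block
  indices; if the letters at positions \<open>i, i + 1\<close> lie in one block, then the word acts by the
  scalar \<open>q\<close>. In that case the standardisation has consecutive values \<open>a, a + 1\<close> at these
  positions, and the terms of the inclusion indexed by \<open>\<tau>\<close> and \<open>\<tau> \<circ> (a a+1)\<close>, whose weights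
  differ by a factor \<open>q\<close>, span a plane in which their weighted sum is a \<open>q\<close>-eigenvector of \<open>T\<^sub>i\<close>.
\<close>

section \<open>Reduction from the full operators to their generators\<close>

text \<open>The relations for the generators hold only on genuine basis elements and for indices
  below \<open>n\<close>. Closure under \<open>T k\<close> keeps every intermediate vector in the
  span of \<open>B\<close>, where agreement on the basis extends by linearity. \<open>X\<close>
  comes last, so the commutation with it is applied to a vector still in that span.\<close>

lemma right_act_intertwine:
  fixes A :: "('b \<Rightarrow>\<^sub>0 real) \<Rightarrow> ('c \<Rightarrow>\<^sub>0 real)"
  assumes lin: "linear A" "\<And>k. linear (T k)" "\<And>k. linear (T' k)" "linear X" "linear X'"
    and closed: "\<And>b k. b \<in> B \<Longrightarrow> 1 \<le> k \<Longrightarrow> k < n \<Longrightarrow> T k (basis b) \<in> span (basis ` B)"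
    and T: "\<And>b k. b \<in> B \<Longrightarrow> 1 \<le> k \<Longrightarrow> k < n \<Longrightarrow> A (T k (basis b)) = T' k (A (basis b))"
    and X: "\<And>b. b \<in> B \<Longrightarrow> 1 \<le> n \<Longrightarrow> A (X (basis b)) = X' (A (basis b))"
    and v: "v \<in> span (basis ` B)"
  shows "A (right_act n T X v) = right_act n T' X' (A v)"
proof -
  have T_span: "A (T k u) = T' k (A u)" "T k u \<in> span (basis ` B)"
    if "u \<in> span (basis ` B)" "1 \<le> k" "k < n" for k u
  proof -
    show "A (T k u) = T' k (A u)"
      using linear_eq_on_span[of "A \<circ> T k" "T' k \<circ> A" "basis ` B" u] lin T that
      by (auto intro: linear_compose)
    have "T k ` span (basis ` B) = span (T k ` basis ` B)"
      by (simp add: lin(2) linear_span_image)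
    also have "\<dots> \<subseteq> span (basis ` B)"
      using closed that by (intro span_minimal) auto
    finally show "T k u \<in> span (basis ` B)"
      using that by auto
  qed
  have X_span: "A (X u) = X' (A u)" if "u \<in> span (basis ` B)" "1 \<le> n" for u
    using linear_eq_on_span[of "A \<circ> X" "X' \<circ> A" "basis ` B" u] lin X that
    by (auto intro: linear_compose)
  \<comment> \<open>Span membership is proved together with the commutation, because each further
    \<open>T k\<close> acts on the vector produced so far; the starting vector is therefore kept
    arbitrary.\<close>
  have fold: "foldl (\<lambda>u k. T k u) u ks \<in> span (basis ` B) \<and>
      A (foldl (\<lambda>u k. T k u) u ks) = foldl (\<lambda>u k. T' k u) (A u) ks"
    if "u \<in> span (basis ` B)" "\<forall>k\<in>set ks. 1 \<le> k \<and> k < n" for u ks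
    using that by (induction ks arbitrary: u) (auto simp: T_span)
  have "A (X (foldl (\<lambda>u k. T k u) v (rev [1..<i]))) = X' (foldl (\<lambda>u k. T' k u) (A v) (rev [1..<i]))"
    if "i \<in> {1..n}" for i
  proof -
    have "\<forall>k\<in>set (rev [1..<i]). 1 \<le> k \<and> k < n"
      using that by auto
    from fold[OF v this] X_span that show ?thesis
      by auto
  qed
  then show ?thesis
    unfolding right_act_def by (simp add: linear_sum[OF lin(1)])
qed

section \<open>Blocks of a composition and the eigenvalues of X\<close>

lemma psum_Suc: "psum m (Suc j) = psum m j + m (Suc j)"
  by (simp add: psum_def)

lemma psum_mono: "j \<le> k \<Longrightarrow> psum m j \<le> psum m k"
  unfolding psum_def by (intro sum_mono2) auto

lemma block_eq: "1 \<le> j \<Longrightarrow> block m j = {psum m (j - 1) + 1..psum m (j - 1) + m j}"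
  using psum_Suc[of m "j - 1"] by (simp add: block_def)

lemma block_less:
  assumes "j < k" "a \<in> block m j" "b \<in> block m k"
  shows "a < b"
proof -
  have "psum m j \<le> psum m (k - 1)"
    using assms(1) by (intro psum_mono) auto
  then show ?thesis
    using assms(2,3) by (auto simp: block_def)
qed

lemma block_unique: "a \<in> block m j \<Longrightarrow> a \<in> block m k \<Longrightarrow> j = k"
  using block_less by (metis less_irrefl nat_neq_iff)

lemma block_subset:
  assumes "composition n l m" "j \<in> {1..l}"
  shows "block m j \<subseteq> {1..n}"
  using assms psum_mono[of j l m] by (auto simp: block_def composition_def psum_def)

lemma block_cover:
  assumes "composition n l m" "p \<in> {1..n}"
  shows "\<exists>j\<in>{1..l}. p \<in> block m j"
proof -
  have "p \<le> psum m l"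
    using assms by (simp add: composition_def psum_def)
  moreover have "\<not> p \<le> psum m 0"
    using assms by (simp add: psum_def)
  \<comment> \<open>The partial sums first reach \<open>p\<close> at \<open>Suc j\<close>, which is
    the index of its block.\<close>
  ultimately obtain j where j: "\<not> p \<le> psum m j" "p \<le> psum m (Suc j)" "j < l"
    using ex_least_nat_less[of "\<lambda>k. p \<le> psum m k" l] by auto
  then show ?thesis
    by (intro bexI[of _ "Suc j"]) (auto simp: block_def)
qed

text \<open>Compatibility allows \<open>p\<close> to be replaced by the last element
  \<open>psum m j\<close> of its block. There the exponent \<open>n - psum m j\<close> is the sum of
  the later parts, and the factor \<open>qint q (m j)\<close> of \<open>xbar j\<close>
  cancels.\<close>

lemma X_weights_agree:
  assumes "q \<ge> 1" "composition n l m" "compatible q n l m x"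
    and "\<And>j. j \<in> {1..l} \<Longrightarrow> xbar j = qint q (m j) * x (psum m j)"
    and j: "j \<in> {1..l}" and p: "p \<in> block m j"
  shows "x p / q ^ (n - p) = xbar j / (q ^ sum m {j + 1..l} * qint q (m j))"
proof -
  have mj: "m j > 0"
    using assms by (auto simp: composition_def)
  \<comment> \<open>The term \<open>q ^ 0\<close> occurs in the sum because the part is nonempty, so
    the denominator is at least 1.\<close>
  have "q ^ 0 \<le> qint q (m j)"
    unfolding qint_def using mj assms(1) by (intro member_le_sum) auto
  then have qn0: "qint q (m j) \<noteq> 0"
    by auto
  have "psum m j \<in> block m j"
    using p by (auto simp: block_def)
  then have eq: "x p / q ^ (n - p) = x (psum m j) / q ^ (n - psum m j)"
    using assms(3) j p unfolding compatible_def constant_on_def by metis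
  have "{1..l} = {1..j} \<union> {j + 1..l}"
    using j by auto
  then have "n = psum m j + sum m {j + 1..l}"
    using assms(2) by (simp add: composition_def psum_def sum.union_disjoint)
  then show ?thesis
    using eq qn0 assms(4)[OF j] by simp
qed

section \<open>Destandardisation and swaps of positions\<close>

lemma transpose_Suc_mem:
  "1 \<le> i \<Longrightarrow> i < n \<Longrightarrow> transpose i (Suc i) p \<in> {1..n} \<longleftrightarrow> p \<in> {1..n}"
  by (auto simp: transpose_def)

lemma destd_apply:
  assumes "i \<in> {1..n}" "j \<in> {1..l}" "\<pi> i \<in> block m j"
  shows "destd n l m \<pi> i = j"
proof -
  have "(THE k. k \<in> {1..l} \<and> \<pi> i \<in> block m k) = j"
    by (rule the_equality) (use assms block_unique in blast)+
  then show ?thesis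
    using assms(1) by (simp add: destd_def)
qed

lemma destd_block:
  assumes "composition n l m" "\<pi> permutes {1..n}" "i \<in> {1..n}"
  shows "destd n l m \<pi> i \<in> {1..l}" "\<pi> i \<in> block m (destd n l m \<pi> i)"
proof -
  have "\<pi> i \<in> {1..n}"
    using permutes_in_image[OF assms(2)] assms(3) by simp
  then obtain j where j: "j \<in> {1..l}" "\<pi> i \<in> block m j"
    using block_cover[OF assms(1)] by blast
  then show "destd n l m \<pi> i \<in> {1..l}" "\<pi> i \<in> block m (destd n l m \<pi> i)"
    using destd_apply[of i n j l \<pi> m, OF assms(3) j] by simp_all
qed

text \<open>Destandardisation acts on values and the swap on positions. The bounds on
  \<open>i\<close> keep the swap inside \<open>{1..n}\<close>, so the restriction to that set is
  respected.\<close>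

lemma destd_comp_transpose:
  assumes "1 \<le> i" "i < n"
  shows "destd n l m (\<pi> \<circ> transpose i (Suc i)) = destd n l m \<pi> \<circ> transpose i (Suc i)"
  using transpose_Suc_mem[OF assms] by (auto simp: destd_def fun_eq_iff)

lemma destd_comp_transpose_same:
  assumes "1 \<le> i" "i < n" "destd n l m \<pi> (Suc i) = destd n l m \<pi> i"
  shows "destd n l m \<pi> \<circ> transpose i (Suc i) = destd n l m \<pi>"
  using assms by (auto simp: fun_eq_iff transpose_def)

lemma permutes_comp_transpose_Suc:
  assumes "1 \<le> i" "i < n" "\<pi> permutes {1..n}"
  shows "\<pi> \<circ> transpose i (Suc i) permutes {1..n}"
  using assms by (intro permutes_compose permutes_swap_id) auto

section \<open>The operators on basis elements and the projection\<close>

lemma linear_perm_word_ops: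
  "linear (perm_T q k)" "linear (perm_X q n x)" "linear (word_T q k)"
  "linear (word_X q l m xbar)" "linear (proj_words n l m)" "linear (incl_perms q n l m)"
  unfolding perm_T_def perm_X_def word_T_def word_X_def proj_words_def incl_perms_def
  by (rule linear_lin_extend)+

lemma perm_T_basis:
  "perm_T q i (basis \<pi>) = (if \<pi> (Suc i) < \<pi> i then q *\<^sub>R basis (\<pi> \<circ> transpose i (Suc i))
     else basis (\<pi> \<circ> transpose i (Suc i)) + (q - 1) *\<^sub>R basis \<pi>)"
  unfolding perm_T_def by (rule lin_extend_basis)

lemma word_T_basis:
  "word_T q i (basis w) = (if w (Suc i) \<le> w i then q *\<^sub>R basis (w \<circ> transpose i (Suc i))
     else basis (w \<circ> transpose i (Suc i)) + (q - 1) *\<^sub>R basis w)"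
  unfolding word_T_def by (rule lin_extend_basis)

lemma proj_words_basis: "proj_words n l m (basis \<pi>) = basis (destd n l m \<pi>)"
  unfolding proj_words_def by (rule lin_extend_basis)

lemma incl_perms_basis:
  "incl_perms q n l m (basis w) =
     (\<Sum>\<tau>\<in>young n l m. (1 / q ^ inv_m l m \<tau>) *\<^sub>R basis (\<tau> \<circ> std n m w))"
  unfolding incl_perms_def by (rule lin_extend_basis)

lemmas perm_word_linear_simps = linear_perm_word_ops[THEN linear_add]
  linear_perm_word_ops[THEN linear_scale]

lemma proj_words_perm_T:
  assumes "composition n l m" "\<pi> permutes {1..n}" "1 \<le> i" "i < n"
  shows "proj_words n l m (perm_T q i (basis \<pi>)) = word_T q i (proj_words n l m (basis \<pi>))"
proof -
  have mem: "i \<in> {1..n}" "Suc i \<in> {1..n}"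
    using assms by auto
  note blocks = destd_block(2)[OF assms(1,2) mem(1)] destd_block(2)[OF assms(1,2) mem(2)]
  consider "destd n l m \<pi> (Suc i) < destd n l m \<pi> i" | "destd n l m \<pi> i < destd n l m \<pi> (Suc i)"
    | "destd n l m \<pi> (Suc i) = destd n l m \<pi> i"
    by linarith
  then show ?thesis
  proof cases
    case 1
    then have "\<pi> (Suc i) < \<pi> i"
      using block_less blocks by blast
    with 1 show ?thesis
      by (simp add: perm_T_basis proj_words_basis word_T_basis perm_word_linear_simps
          destd_comp_transpose[OF assms(3,4)])
  next
    case 2
    then have "\<pi> i < \<pi> (Suc i)"
      using block_less blocks by blast
    with 2 show ?thesis
      by (simp add: perm_T_basis proj_words_basis word_T_basis perm_word_linear_simps
          destd_comp_transpose[OF assms(3,4)])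
  next
    case 3
    \<comment> \<open>The swap fixes the word, so both branches of \<open>perm_T\<close> project to
      the scalar \<open>q\<close>; in the ascending branch this is
      \<open>1 + (q - 1) = q\<close>.\<close>
    then show ?thesis
      by (simp add: perm_T_basis proj_words_basis word_T_basis perm_word_linear_simps
          destd_comp_transpose[OF assms(3,4)] destd_comp_transpose_same[OF assms(3,4)]
          scaleR_left_diff_distrib linear_diff[OF linear_perm_word_ops(5)])
  qed
qed

lemma perm_T_span:
  assumes "\<pi> permutes {1..n}" "1 \<le> i" "i < n"
  shows "perm_T q i (basis \<pi>) \<in> span (basis ` {\<pi>. \<pi> permutes {1..n}})"
  using assms permutes_comp_transpose_Suc[OF assms(2,3,1)]
  by (auto simp: perm_T_basis intro!: span_add span_scale intro: span_base)

section \<open>Words and their standardisation\<close>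

lemma words_comp_transpose:
  assumes "w \<in> words n l m" "1 \<le> i" "i < n"
  shows "w \<circ> transpose i (Suc i) \<in> words n l m"
proof -
  let ?s = "transpose i (Suc i)"
  note mem = transpose_Suc_mem[OF assms(2,3)]
  have w: "w \<in> {1..n} \<rightarrow>\<^sub>E {1..l}" "\<And>j. j \<in> {1..l} \<Longrightarrow> card {p\<in>{1..n}. w p = j} = m j"
    using assms by (auto simp: words_def)
  have "w \<circ> ?s \<in> {1..n} \<rightarrow>\<^sub>E {1..l}"
    using w(1) mem by (fastforce simp: PiE_iff extensional_def)
  moreover have "card {p\<in>{1..n}. (w \<circ> ?s) p = j} = m j" if "j \<in> {1..l}" for j
  proof -
    have "?s ` {p\<in>{1..n}. (w \<circ> ?s) p = j} = {p\<in>{1..n}. w p = j}"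
    proof
      show "{p\<in>{1..n}. w p = j} \<subseteq> ?s ` {p\<in>{1..n}. (w \<circ> ?s) p = j}"
      proof
        fix p assume "p \<in> {p\<in>{1..n}. w p = j}"
        then have "p = ?s (?s p)" "?s p \<in> {p\<in>{1..n}. (w \<circ> ?s) p = j}"
          using mem[of p] by simp_all
        then show "p \<in> ?s ` {p\<in>{1..n}. (w \<circ> ?s) p = j}"
          by (rule image_eqI)
      qed
    qed (use mem in auto)
    moreover have "card (?s ` {p\<in>{1..n}. (w \<circ> ?s) p = j}) = card {p\<in>{1..n}. (w \<circ> ?s) p = j}"
      by (intro card_image inj_on_transpose)
    ultimately show ?thesis
      using w(2)[OF that] by (simp only:)
  qed
  ultimately show ?thesis
    by (simp add: words_def)
qed

lemma word_T_span:
  assumes "w \<in> words n l m" "1 \<le> i" "i < n"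
  shows "word_T q i (basis w) \<in> span (basis ` words n l m)"
  using assms words_comp_transpose[OF assms]
  by (auto simp: word_T_basis intro!: span_add span_scale intro: span_base)

lemma std_block:
  assumes "w \<in> words n l m" "p \<in> {1..n}"
  shows "w p \<in> {1..l}" "std n m w p \<in> block m (w p)"
proof -
  show wp: "w p \<in> {1..l}"
    using assms by (auto simp: words_def)
  have "card {k\<in>{1..p}. w k = w p} \<le> card {k\<in>{1..n}. w k = w p}"
    using assms by (intro card_mono) auto
  also have "\<dots> = m (w p)"
    using assms wp by (auto simp: words_def)
  finally have "card {k\<in>{1..p}. w k = w p} \<le> m (w p)" .
  \<comment> \<open>Position \<open>p\<close> counts itself, so its rank among equal letters starts
    at 1, matching the left end of the block.\<close>
  moreover have "card {k\<in>{1..p}. w k = w p} > 0"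
    using assms by (auto simp: card_gt_0_iff)
  ultimately show "std n m w p \<in> block m (w p)"
    using wp assms(2) block_eq[of "w p" m] by (auto simp: std_def)
qed

lemma std_less:
  assumes "a \<in> {1..n}" "b \<in> {1..n}" "a < b" "w a = w b"
  shows "std n m w a < std n m w b"
proof -
  have "card {k\<in>{1..a}. w k = w a} < card {k\<in>{1..b}. w k = w b}"
  proof (rule psubset_card_mono)
    have "b \<in> {k\<in>{1..b}. w k = w b}" "b \<notin> {k\<in>{1..a}. w k = w a}"
      using assms by auto
    moreover have "{k\<in>{1..a}. w k = w a} \<subseteq> {k\<in>{1..b}. w k = w b}"
      using assms by auto
    ultimately show "{k\<in>{1..a}. w k = w a} \<subset> {k\<in>{1..b}. w k = w b}"
      by blast
  qed simp
  then show ?thesis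
    using assms by (simp add: std_def)
qed

text \<open>The block of a value recovers the letter, and within one letter the values increase with
  the position.\<close>

lemma inj_std:
  assumes "composition n l m" "w \<in> words n l m"
  shows "inj (std n m w)"
proof (rule injI)
  fix a b assume eq: "std n m w a = std n m w b"
  \<comment> \<open>Outside \<open>{1..n}\<close> the standardisation is the identity, so inside and
    outside values cannot collide.\<close>
  have range: "std n m w p \<in> {1..n} \<longleftrightarrow> p \<in> {1..n}" for p
    using std_block[OF assms(2), of p] block_subset[OF assms(1), of "w p"]
    by (cases "p \<in> {1..n}") (auto simp: std_def)
  show "a = b"
  proof (cases "a \<in> {1..n}")
    case True
    then have b: "b \<in> {1..n}"
      using range eq by metis
    have "w a = w b"
      using std_block(2)[OF assms(2)] True b eq block_unique by metis
    then show ?thesis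
      using std_less[of a n b w m] std_less[of b n a w m] True b eq by (metis less_irrefl nat_neq_iff)
  next
    case False
    then have "b \<notin> {1..n}"
      using range eq by metis
    with False eq show ?thesis
      by (auto simp: std_def)
  qed
qed

text \<open>Ranks depend only on the relative order of equal letters, which swapping two distinct
  neighbours leaves intact.\<close>

lemma std_comp_transpose:
  assumes "1 \<le> i" "i < n" "w i \<noteq> w (Suc i)"
  shows "std n m (w \<circ> transpose i (Suc i)) = std n m w \<circ> transpose i (Suc i)"
proof
  fix p
  let ?s = "transpose i (Suc i)"
  note mem = transpose_Suc_mem[OF assms(1,2)]
  show "std n m (w \<circ> ?s) p = (std n m w \<circ> ?s) p"
  proof (cases "p \<in> {1..n}")
    case True
    \<comment> \<open>The swap reverses only the pair of positions \<open>i\<close>,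
      \<open>Suc i\<close>, and that pair is excluded because its letters differ.\<close>
    have sub: "?s k \<in> {1..?s p}" if "k \<in> {1..p}" "w (?s k) = w (?s p)" for k
      using that assms by (auto simp: transpose_def split: if_splits)
    have sub': "?s k \<in> {1..p}" if "k \<in> {1..?s p}" "w k = w (?s p)" for k
      using that assms by (auto simp: transpose_def split: if_splits)
    have "?s ` {k\<in>{1..p}. w (?s k) = w (?s p)} = {k\<in>{1..?s p}. w k = w (?s p)}"
    proof
      show "{k\<in>{1..?s p}. w k = w (?s p)} \<subseteq> ?s ` {k\<in>{1..p}. w (?s k) = w (?s p)}"
      proof
        fix k assume "k \<in> {k\<in>{1..?s p}. w k = w (?s p)}"
        then have "k = ?s (?s k)" "?s k \<in> {k\<in>{1..p}. w (?s k) = w (?s p)}"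
          using sub'[of k] by simp_all
        then show "k \<in> ?s ` {k\<in>{1..p}. w (?s k) = w (?s p)}"
          by (rule image_eqI)
      qed
    qed (use sub in auto)
    moreover have "card (?s ` {k\<in>{1..p}. w (?s k) = w (?s p)}) = card {k\<in>{1..p}. w (?s k) = w (?s p)}"
      by (intro card_image inj_on_transpose)
    ultimately have "card {k\<in>{1..p}. w (?s k) = w (?s p)} = card {k\<in>{1..?s p}. w k = w (?s p)}"
      by (simp only:)
    then show ?thesis
      using True mem[of p] by (simp add: std_def)
  next
    case False
    then have "?s p = p"
      using assms by (auto simp: transpose_def)
    then show ?thesis
      using False by (simp only: std_def o_apply if_False)
  qed
qed

lemma std_Suc:
  assumes "1 \<le> i" "i < n" "w i = w (Suc i)"
  shows "std n m w (Suc i) = Suc (std n m w i)"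
proof -
  have "{k\<in>{1..Suc i}. w k = w (Suc i)} = insert (Suc i) {k\<in>{1..i}. w k = w (Suc i)}"
    using assms by (auto simp: le_Suc_eq)
  then show ?thesis
    using assms by (simp add: std_def)
qed

section \<open>The Young subgroup and its inversion statistic\<close>

lemma young_block: "\<tau> \<in> young n l m \<Longrightarrow> j \<in> {1..l} \<Longrightarrow> a \<in> block m j \<Longrightarrow> \<tau> a \<in> block m j"
  unfolding young_def by blast

lemma transpose_image_block:
  assumes "a \<in> block m j" "b \<in> block m j"
  shows "transpose a b ` block m k = block m k"
proof (cases "k = j")
  case False
  then have "a \<notin> block m k" "b \<notin> block m k"
    using assms block_unique by blast+
  then show ?thesis
    by (simp add: transpose_image_eq)
qed (use assms in \<open>simp add: transpose_image_eq\<close>)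

lemma young_comp_transpose:
  assumes "composition n l m" "\<tau> \<in> young n l m" "j \<in> {1..l}" "a \<in> block m j" "b \<in> block m j"
  shows "\<tau> \<circ> transpose a b \<in> young n l m"
proof -
  have "\<tau> \<circ> transpose a b permutes {1..n}"
    using assms block_subset[OF assms(1,3)]
    by (intro permutes_compose permutes_swap_id) (auto simp: young_def)
  then show ?thesis
    using assms(2) transpose_image_block[OF assms(4,5)]
    by (simp only: young_def mem_Collect_eq image_comp[symmetric]) blast
qed

text \<open>Applying the swap to both entries of a pair carries the inversions of
  \<open>\<tau>\<close> bijectively to those of the composite, except for the new inversion
  \<open>(a, Suc a)\<close>.\<close>

lemma card_inversions_comp_transpose:
  fixes \<tau> :: "nat \<Rightarrow> nat"
  assumes "finite B" "a \<in> B" "Suc a \<in> B" "\<tau> a < \<tau> (Suc a)"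
  shows "card {(x, y). x \<in> B \<and> y \<in> B \<and> x < y \<and> (\<tau> \<circ> transpose a (Suc a)) y < (\<tau> \<circ> transpose a (Suc a)) x}
    = Suc (card {(x, y). x \<in> B \<and> y \<in> B \<and> x < y \<and> \<tau> y < \<tau> x})" (is "card ?L = Suc (card ?R)")
proof -
  let ?s = "transpose a (Suc a)"
  have B: "?s x \<in> B \<longleftrightarrow> x \<in> B" for x
    using assms by (auto simp: transpose_def)
  \<comment> \<open>No number lies strictly between \<open>a\<close> and \<open>Suc a\<close>, so
    every other pair keeps its order.\<close>
  have mono: "?s x < ?s y" if "x < y" "(x, y) \<noteq> (a, Suc a)" for x y
    using that by (auto simp: transpose_def)
  have 1: "map_prod ?s ?s z \<in> ?L" if "z \<in> ?R" for z
  proof (cases z)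
    case (Pair x y)
    then have "x < y" "(x, y) \<noteq> (a, Suc a)"
      using that assms(4) by auto
    then show ?thesis
      using mono that Pair B by simp
  qed
  have 2: "map_prod ?s ?s z \<in> ?R" if "z \<in> ?L" "z \<noteq> (a, Suc a)" for z
  proof (cases z)
    case (Pair x y)
    then have "x < y" "(x, y) \<noteq> (a, Suc a)"
      using that by auto
    then show ?thesis
      using mono that Pair B by simp
  qed
  have "?L = insert (a, Suc a) (map_prod ?s ?s ` ?R)"
  proof
    show "?L \<subseteq> insert (a, Suc a) (map_prod ?s ?s ` ?R)"
    proof
      fix z assume z: "z \<in> ?L"
      show "z \<in> insert (a, Suc a) (map_prod ?s ?s ` ?R)"
      proof (cases "z = (a, Suc a)")
        case False
        moreover have "z = map_prod ?s ?s (map_prod ?s ?s z)"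
          by (cases z) simp
        ultimately show ?thesis
          using image_eqI[OF _ 2[OF z]] by (intro insertI2)
      qed simp
    qed
    show "insert (a, Suc a) (map_prod ?s ?s ` ?R) \<subseteq> ?L"
      using 1 assms by auto
  qed
  moreover have "(a, Suc a) \<notin> map_prod ?s ?s ` ?R"
  proof
    assume "(a, Suc a) \<in> map_prod ?s ?s ` ?R"
    then obtain x y where "x < y" "?s x = a" "?s y = Suc a"
      by auto
    then show False
      by (auto simp: transpose_def split: if_splits)
  qed
  moreover have "finite ?R"
    by (rule finite_subset[of _ "B \<times> B"]) (use assms in auto)
  moreover have "inj_on (map_prod ?s ?s) ?R"
    using prod.inj_map[of ?s ?s] by (auto intro: inj_on_subset)
  ultimately show ?thesis
    by (simp add: card_image)
qed

lemma inv_m_comp_transpose: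
  assumes "j \<in> {1..l}" "a \<in> block m j" "Suc a \<in> block m j" "\<tau> a < \<tau> (Suc a)"
  shows "inv_m l m (\<tau> \<circ> transpose a (Suc a)) = Suc (inv_m l m \<tau>)"
proof -
  \<comment> \<open>The contribution of a single block to \<open>inv_m\<close>; only that of block
    \<open>j\<close> changes.\<close>
  define c where "c = (\<lambda>\<tau> k. card {(x, y). x \<in> block m k \<and> y \<in> block m k \<and> x < y \<and> \<tau> y < (\<tau> x :: nat)})"
  let ?\<sigma> = "\<tau> \<circ> transpose a (Suc a)"
  have "c ?\<sigma> j = Suc (c \<tau> j)"
    unfolding c_def using assms by (intro card_inversions_comp_transpose) (auto simp: block_def)
  moreover have "c ?\<sigma> k = c \<tau> k" if "k \<noteq> j" for k
  proof -
    have "a \<notin> block m k" "Suc a \<notin> block m k"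
      using assms that block_unique by blast+
    then have "?\<sigma> x = \<tau> x" if "x \<in> block m k" for x
      using that by (auto simp: transpose_def)
    then have "{(x, y). x \<in> block m k \<and> y \<in> block m k \<and> x < y \<and> ?\<sigma> y < ?\<sigma> x} =
        {(x, y). x \<in> block m k \<and> y \<in> block m k \<and> x < y \<and> \<tau> y < \<tau> x}"
      by (auto simp del: o_apply)
    then show ?thesis
      by (simp only: c_def)
  qed
  then have "sum (c ?\<sigma>) ({1..l} - {j}) = sum (c \<tau>) ({1..l} - {j})"
    by (intro sum.cong) auto
  moreover have "sum (c \<rho>) {1..l} = c \<rho> j + sum (c \<rho>) ({1..l} - {j})" for \<rho>
    using assms(1) by (intro sum.remove) auto
  moreover have "inv_m l m \<rho> = sum (c \<rho>) {1..l}" for \<rho>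
    by (simp only: inv_m_def c_def)
  ultimately show ?thesis
    by (simp only: add_Suc)
qed

section \<open>The inclusion\<close>

text \<open>Reindexing by \<open>h\<close> shows that the two doubled sums agree, and doubling can
  be undone over the reals. This avoids choosing a representative of each pair.\<close>

lemma sum_eq_by_involution:
  fixes f g :: "'a \<Rightarrow> 'b::real_vector"
  assumes "\<And>t. t \<in> S \<Longrightarrow> h t \<in> S" "\<And>t. t \<in> S \<Longrightarrow> h (h t) = t"
    and "\<And>t. t \<in> S \<Longrightarrow> f t + f (h t) = g t + g (h t)"
  shows "sum f S = sum g S"
proof -
  have h: "(\<Sum>t\<in>S. F (h t)) = sum F S" for F :: "'a \<Rightarrow> 'b"
    using assms by (intro sum.reindex_bij_witness[of _ h h]) auto
  have "sum f S + sum f S = (\<Sum>t\<in>S. f t + f (h t))"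
    by (simp add: sum.distrib h)
  also have "\<dots> = sum g S + sum g S"
    by (simp add: assms(3) sum.distrib h)
  finally show ?thesis
    by (simp flip: scaleR_2)
qed

lemma incl_perms_word_T_same:
  assumes "q > 0" "composition n l m" "w \<in> words n l m" "1 \<le> i" "i < n" "w (Suc i) = w i"
  shows "(\<Sum>\<tau>\<in>young n l m. (1 / q ^ inv_m l m \<tau>) *\<^sub>R perm_T q i (basis (\<tau> \<circ> std n m w)))
    = (\<Sum>\<tau>\<in>young n l m. (1 / q ^ inv_m l m \<tau>) *\<^sub>R q *\<^sub>R basis (\<tau> \<circ> std n m w))"
    (is "sum ?f _ = sum ?g _")
proof -
  define a where "a = std n m w i"
  let ?s = "transpose a (Suc a)"
  have a_Suc: "std n m w (Suc i) = Suc a"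
    using std_Suc[of i n w m] assms by (simp add: a_def)
  have wi: "w i \<in> {1..l}" "a \<in> block m (w i)"
    using std_block[OF assms(3), of i] assms by (auto simp: a_def)
  have Sa: "Suc a \<in> block m (w i)"
    using std_block(2)[OF assms(3), of "Suc i"] a_Suc assms by auto
  \<comment> \<open>By injectivity the values \<open>a\<close> and \<open>Suc a\<close> occur only
    at positions \<open>i\<close> and \<open>Suc i\<close>, so swapping positions amounts to
    swapping values.\<close>
  have comm: "std n m w \<circ> transpose i (Suc i) = ?s \<circ> std n m w"
  proof
    fix p
    have "std n m w p = a \<longleftrightarrow> p = i" "std n m w p = Suc a \<longleftrightarrow> p = Suc i"
      using inj_eq[OF inj_std[OF assms(2,3)], of p i] inj_eq[OF inj_std[OF assms(2,3)], of p "Suc i"]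
      unfolding a_Suc a_def[symmetric] by simp_all
    moreover have "p = i \<or> p = Suc i \<or> (p \<noteq> i \<and> p \<noteq> Suc i)"
      by blast
    ultimately show "(std n m w \<circ> transpose i (Suc i)) p = (?s \<circ> std n m w) p"
      using a_Suc a_def by (elim disjE conjE) simp_all
  qed
  \<comment> \<open>Let \<open>u\<close>, \<open>v\<close> be the basis vectors of
    \<open>\<tau>\<close> and \<open>\<tau> \<circ> ?s\<close>, and \<open>c\<close> the weight of
    \<open>u\<close>; that of \<open>v\<close> is \<open>c / q\<close>. Then
    \<open>T u = v + (q - 1) u\<close> and \<open>T v = q u\<close>, so \<open>T\<close> sends
    \<open>c u + (c / q) v\<close> to \<open>c v + c q u\<close>, which is \<open>q\<close> times
    it.\<close>
  have pair: "?f \<tau> + ?f (\<tau> \<circ> ?s) = ?g \<tau> + ?g (\<tau> \<circ> ?s)" if "\<tau> a < \<tau> (Suc a)" for \<tau>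
  proof -
    have comm': "\<tau> \<circ> std n m w \<circ> transpose i (Suc i) = \<tau> \<circ> ?s \<circ> std n m w"
      by (simp add: comp_assoc comm)
    have comm'': "\<tau> \<circ> ?s \<circ> std n m w \<circ> transpose i (Suc i) = \<tau> \<circ> std n m w"
      by (simp add: comp_assoc comm) (simp flip: comp_assoc)
    show ?thesis
      using that assms(1) inv_m_comp_transpose[OF wi Sa that]
      by (simp add: perm_T_basis comm' comm'' a_Suc flip: a_def)
        (simp add: algebra_simps)
  qed
  show ?thesis
  proof (rule sum_eq_by_involution[where h = "\<lambda>\<tau>. \<tau> \<circ> ?s"])
    fix \<tau> assume \<tau>: "\<tau> \<in> young n l m"
    show "\<tau> \<circ> ?s \<in> young n l m"
      by (rule young_comp_transpose[OF assms(2) \<tau> wi Sa])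
    show invol: "\<tau> \<circ> ?s \<circ> ?s = \<tau>"
      by (simp add: comp_assoc)
    have "inj \<tau>"
      using \<tau> permutes_inj by (auto simp: young_def)
    then have "\<tau> a \<noteq> \<tau> (Suc a)"
      by (simp add: inj_eq)
    \<comment> \<open>One member of each pair is ascending at \<open>a\<close>, and the identity is
      symmetric in the two members.\<close>
    then have "\<tau> a < \<tau> (Suc a) \<or> (\<tau> \<circ> ?s) a < (\<tau> \<circ> ?s) (Suc a)"
      by auto
    then show "?f \<tau> + ?f (\<tau> \<circ> ?s) = ?g \<tau> + ?g (\<tau> \<circ> ?s)"
      using pair[of \<tau>] pair[of "\<tau> \<circ> ?s"] unfolding invol by (auto simp: add.commute)
  qed
qed

lemma incl_perms_word_T:
  assumes "q > 0" "composition n l m" "w \<in> words n l m" "1 \<le> i" "i < n"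
  shows "incl_perms q n l m (word_T q i (basis w)) = perm_T q i (incl_perms q n l m (basis w))"
proof -
  have mem: "i \<in> {1..n}" "Suc i \<in> {1..n}"
    using assms by auto
  note blocks = std_block[OF assms(3) mem(1)] std_block[OF assms(3) mem(2)]
  have R: "perm_T q i (incl_perms q n l m (basis w)) =
      (\<Sum>\<tau>\<in>young n l m. (1 / q ^ inv_m l m \<tau>) *\<^sub>R perm_T q i (basis (\<tau> \<circ> std n m w)))"
    by (simp add: incl_perms_basis linear_sum[OF linear_perm_word_ops(1)] perm_word_linear_simps)
  consider "w (Suc i) = w i" | "w (Suc i) < w i" | "w i < w (Suc i)"
    by linarith
  then show ?thesis
  proof cases
    case 1
    then have "w \<circ> transpose i (Suc i) = w"
      by (auto simp: fun_eq_iff transpose_def)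
    then have "incl_perms q n l m (word_T q i (basis w)) =
        (\<Sum>\<tau>\<in>young n l m. (1 / q ^ inv_m l m \<tau>) *\<^sub>R q *\<^sub>R basis (\<tau> \<circ> std n m w))"
      using 1 by (simp add: word_T_basis perm_word_linear_simps incl_perms_basis
          scaleR_sum_right mult.commute)
    then show ?thesis
      using R incl_perms_word_T_same[OF assms 1] by simp
  next
    case 2
    \<comment> \<open>Since \<open>\<tau>\<close> preserves blocks, the letters of \<open>w\<close>
      decide the order for every \<open>\<tau>\<close> at once: all terms take the same branch as
      the word.\<close>
    have "\<tau> (std n m w (Suc i)) < \<tau> (std n m w i)" if "\<tau> \<in> young n l m" for \<tau>
      using block_less[OF 2] young_block[OF that] blocks by blast
    then show ?thesis
      unfolding R using 2 std_comp_transpose[of i n w m] assms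
      by (simp add: word_T_basis perm_T_basis perm_word_linear_simps incl_perms_basis
          scaleR_sum_right mult.commute comp_assoc cong: sum.cong)
  next
    case 3
    have "\<tau> (std n m w i) < \<tau> (std n m w (Suc i))" if "\<tau> \<in> young n l m" for \<tau>
      using block_less[OF 3] young_block[OF that] blocks by blast
    then have "perm_T q i (basis (\<tau> \<circ> std n m w)) =
        basis (\<tau> \<circ> std n m w \<circ> transpose i (Suc i)) + (q - 1) *\<^sub>R basis (\<tau> \<circ> std n m w)"
      if "\<tau> \<in> young n l m" for \<tau>
      using that by (auto simp: perm_T_basis dest: less_asym)
    then show ?thesis
      unfolding R using 3 std_comp_transpose[of i n w m] assms
      by (simp add: word_T_basis perm_word_linear_simps incl_perms_basis
          scaleR_sum_right mult.commute comp_assoc scaleR_right_distrib sum.distrib cong: sum.cong)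
  qed
qed

section \<open>Assembling the two intertwining identities\<close>

theorem theorem3p15:
  fixes q :: real and n l :: nat and m :: "nat \<Rightarrow> nat" and x xbar :: "nat \<Rightarrow> real"
  assumes "q \<ge> 1"
    and "composition n l m"
    and "\<And>i. i \<in> {1..n} \<Longrightarrow> x i > 0"
    and "(\<Sum>i=1..n. x i) = 1"
    and "compatible q n l m x"
    and "\<And>j. j \<in> {1..l} \<Longrightarrow> xbar j = qint q (m j) * x (psum m j)"
  shows "(\<forall>\<pi>. \<pi> permutes {1..n} \<longrightarrow>
            proj_words n l m (perm_act q n x (basis \<pi>)) =
              word_act q n l m xbar (proj_words n l m (basis \<pi>))) \<and>
         (\<forall>w\<in>words n l m.
            incl_perms q n l m (word_act q n l m xbar (basis w)) =
              perm_act q n x (incl_perms q n l m (basis w)))"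
proof -
  have weights: "x p / q ^ (n - p) = xbar j / (q ^ sum m {j + 1..l} * qint q (m j))"
    if "j \<in> {1..l}" "p \<in> block m j" for j p
    by (rule X_weights_agree[OF assms(1,2,5)]) (use assms(6) that in auto)
  show ?thesis
  proof (intro conjI allI impI ballI)
    fix \<pi> assume \<pi>: "\<pi> permutes {1..n}"
    show "proj_words n l m (perm_act q n x (basis \<pi>)) =
        word_act q n l m xbar (proj_words n l m (basis \<pi>))"
      unfolding perm_act_def word_act_def
    proof (rule right_act_intertwine[where B = "{\<pi>. \<pi> permutes {1..n}}"])
      fix \<pi> assume "\<pi> \<in> {\<pi>. \<pi> permutes {1..n}}" "1 \<le> n"
      then have "destd n l m \<pi> 1 \<in> {1..l}" "\<pi> 1 \<in> block m (destd n l m \<pi> 1)"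
        using destd_block[OF assms(2), of \<pi> 1] by auto
      from weights[OF this]
      show "proj_words n l m (perm_X q n x (basis \<pi>)) =
          word_X q l m xbar (proj_words n l m (basis \<pi>))"
        by (simp add: perm_X_def word_X_def proj_words_def lin_extend_basis
            linear_scale[OF linear_lin_extend])
    qed (use \<pi> in \<open>auto intro: linear_perm_word_ops perm_T_span proj_words_perm_T[OF assms(2)]
        span_base simp del: One_nat_def\<close>)
  next
    fix w assume w: "w \<in> words n l m"
    show "incl_perms q n l m (word_act q n l m xbar (basis w)) =
        perm_act q n x (incl_perms q n l m (basis w))"
      unfolding perm_act_def word_act_def
    proof (rule right_act_intertwine[where B = "words n l m"])
      fix w assume w: "w \<in> words n l m" and "1 \<le> n"
      then have w1: "w 1 \<in> {1..l}" "std n m w 1 \<in> block m (w 1)"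
        using std_block[OF w, of 1] by auto
      \<comment> \<open>The eigenvalue of X on \<open>w\<close>. Every
        \<open>\<tau> \<circ> std n m w\<close> starts with a letter of block \<open>w 1\<close>, so
        all terms of the inclusion share it.\<close>
      let ?c = "xbar (w 1) / (q ^ (sum m {w 1 + 1..l}) * qint q (m (w 1)))"
      have "perm_X q n x (basis (\<tau> \<circ> std n m w)) = ?c *\<^sub>R basis (\<tau> \<circ> std n m w)"
        if "\<tau> \<in> young n l m" for \<tau>
        using weights[OF w1(1) young_block[OF that w1]]
        by (simp add: perm_X_def lin_extend_basis)
      moreover have "word_X q l m xbar (basis w) = ?c *\<^sub>R basis w"
        by (simp add: word_X_def lin_extend_basis)
      ultimately show "incl_perms q n l m (word_X q l m xbar (basis w)) =
          perm_X q n x (incl_perms q n l m (basis w))"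
        by (simp add: perm_word_linear_simps incl_perms_basis scaleR_sum_right mult.commute
            linear_sum[OF linear_perm_word_ops(2)])
    qed (use w assms(1) in \<open>auto intro: linear_perm_word_ops word_T_span
        incl_perms_word_T[OF _ assms(2)] span_base\<close>)
  qed
qed

end
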